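(* Let $1\le p<\infty$ and $d=1$. There are constants $A,B,C\in\mathbb{N}$ such that for all $l:\mathbb{N}\to\mathbb{N}$ and all $n\in\mathbb{N}$, $|K^p_l|(n)\le 2^{A\,l(n+d+1)+l(0)+B}+n+C$.
   Context: Here $d=1$ is the dimension of the domain $[0,1]$. $\tilde f$ is $f$ extended by zero to $\mathbb{R}$, $(\tau_hg)(x)=g(x+h)$. An $L^p$-modulus of $f\in L^p([0,1])$ is $\mu:\mathbb{N}\to\mathbb{N}$ with $|h|\le2^{-\mu(n)}\Rightarrow\|\tilde f-\tau_h\tilde f\|_p<2^{-n}$ for all $n\in\mathbb{N},h\in\mathbb{R}$, and $\mu(n)\ne0\Rightarrow\mu(n+1)>\mu(n)$. For $l:\mathbb{N}\to\mathbb{N}$, $K^p_l:=\{f\in L^p([0,1]): l\text{ is an }L^p\text{-modulus of }f\}$. The metric entropy of a subset $K$ of a metric space is $|K|(n):=\min\{k\in\mathbb{N}: K\text{ can be covered by }2^k\text{ balls of radius }2^{-n}\}$ (here in the $L^p$ metric). *)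

theory Defs
  imports "HOL-Analysis.Analysis"
begin

section \<open>The metric space of classes of p-integrable functions\<close>

definition Lp_funs :: "'a measure \<Rightarrow> real \<Rightarrow> ('a \<Rightarrow> real) set" where
  "Lp_funs M p = {f \<in> borel_measurable M. integrable M (\<lambda>x. \<bar>f x\<bar> powr p)}"

definition Lp_norm :: "'a measure \<Rightarrow> real \<Rightarrow> ('a \<Rightarrow> real) \<Rightarrow> real" where
  "Lp_norm M p f = (\<integral>x. \<bar>f x\<bar> powr p \<partial>M) powr (1 / p)"

definition Lp_rel :: "'a measure \<Rightarrow> real \<Rightarrow> (('a \<Rightarrow> real) \<times> ('a \<Rightarrow> real)) set" where
  "Lp_rel M p = {(f, g). f \<in> Lp_funs M p \<and> g \<in> Lp_funs M p \<and> (AE x in M. f x = g x)}"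

definition Lp_space :: "'a measure \<Rightarrow> real \<Rightarrow> ('a \<Rightarrow> real) set set" where
  "Lp_space M p = Lp_funs M p // Lp_rel M p"

definition Lp_rep :: "('a \<Rightarrow> real) set \<Rightarrow> 'a \<Rightarrow> real" where
  "Lp_rep F = (SOME f. f \<in> F)"

definition Lp_dist :: "'a measure \<Rightarrow> real \<Rightarrow> ('a \<Rightarrow> real) set \<Rightarrow> ('a \<Rightarrow> real) set \<Rightarrow> real" where
  "Lp_dist M p F G = Lp_norm M p (\<lambda>x. Lp_rep F x - Lp_rep G x)"

definition Lp_metric :: "'a measure \<Rightarrow> real \<Rightarrow> ('a \<Rightarrow> real) set metric" where
  "Lp_metric M p = metric (Lp_space M p, Lp_dist M p)"

section \<open>Metric entropy\<close>

text \<open>Balls are open and centred anywhere in the ambient space. The value is \<open>\<infinity>\<close> if no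
  finite cover by balls of the given radius exists; otherwise the infimum is attained.\<close>

definition metric_entropy :: "'a metric \<Rightarrow> 'a set \<Rightarrow> nat \<Rightarrow> enat" where
  "metric_entropy m K n =
     (INF k \<in> {k. \<exists>c. (\<forall>i<2^k. c i \<in> mspace m) \<and>
                     K \<subseteq> (\<Union>i\<in>{..<(2::nat)^k}. mball_of m (c i) (1 / 2 ^ n))}. enat k)"

section \<open>Moduli on the unit interval\<close>

definition zero_ext :: "(real \<Rightarrow> real) \<Rightarrow> real \<Rightarrow> real" where
  "zero_ext f x = (if x \<in> {0..1} then f x else 0)"

definition translate :: "real \<Rightarrow> (real \<Rightarrow> real) \<Rightarrow> real \<Rightarrow> real" where
  "translate h g x = g (x + h)"

definition Lp_modulus :: "real \<Rightarrow> (nat \<Rightarrow> nat) \<Rightarrow> (real \<Rightarrow> real) \<Rightarrow> bool" where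
  "Lp_modulus p \<mu> f \<longleftrightarrow>
     (\<forall>n h. \<bar>h\<bar> \<le> 1 / 2 ^ \<mu> n \<longrightarrow>
        Lp_norm lebesgue p (\<lambda>x. zero_ext f x - translate h (zero_ext f) x) < 1 / 2 ^ n) \<and>
     (\<forall>n. \<mu> n \<noteq> 0 \<longrightarrow> \<mu> (n + 1) > \<mu> n)"

abbreviation Lp01 :: "real \<Rightarrow> (real \<Rightarrow> real) set metric" where
  "Lp01 p \<equiv> Lp_metric (lebesgue_on {0..1}) p"

text \<open>Quantifying over all representatives is harmless: being a modulus does not depend on the
  representative, see \<open>Lp_modulus_cong_AE\<close> below.\<close>

definition Lp_modulus_class :: "real \<Rightarrow> (nat \<Rightarrow> nat) \<Rightarrow> (real \<Rightarrow> real) set set" where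
  "Lp_modulus_class p l = {F \<in> mspace (Lp01 p). \<forall>f\<in>F. Lp_modulus p l f}"

section \<open>Well-definedness\<close>

lemma powr_convex_combination:
  fixes u v t p :: real
  assumes p: "1 \<le> p" and "0 \<le> u" "0 \<le> v" "0 \<le> t" "t \<le> 1"
  shows "(t * u + (1 - t) * v) powr p \<le> t * u powr p + (1 - t) * v powr p"
proof -
  have le: "(s * w) powr p \<le> s * w powr p" if "0 \<le> s" "s \<le> 1" "0 \<le> w" for s w :: real
  proof -
    have "s powr p \<le> s"
      using that p powr_mono'[of 1 p s] by (cases "s = 0") auto
    then show ?thesis using that by (simp add: powr_mult mult_right_mono)
  qed
  consider "u = 0" | "v = 0" | "u > 0" "v > 0" using assms by linarith
  then show ?thesis
  proof cases
    case 1
    then show ?thesis using le[of "1 - t" v] assms by simp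
  next
    case 2
    then show ?thesis using le[of t u] assms by simp
  next
    case 3
    then show ?thesis
      using convex_onD[OF powr_convex[OF p], of t v u] assms by (simp add: add.commute)
  qed
qed

lemma Lp_funs_diff:
  assumes p: "1 \<le> p" and f: "f \<in> Lp_funs M p" and g: "g \<in> Lp_funs M p"
  shows "(\<lambda>x. f x - g x) \<in> Lp_funs M p"
proof -
  have [measurable]: "f \<in> borel_measurable M" "g \<in> borel_measurable M"
    using f g by (auto simp: Lp_funs_def)
  have bound: "\<bar>f x - g x\<bar> powr p \<le> 2 powr p * (\<bar>f x\<bar> powr p + \<bar>g x\<bar> powr p)" for x
  proof -
    have "\<bar>f x - g x\<bar> powr p \<le> (2 * (1/2 * \<bar>f x\<bar> + (1 - 1/2) * \<bar>g x\<bar>)) powr p"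
      using p by (intro powr_mono2) auto
    also have "\<dots> = 2 powr p * (1/2 * \<bar>f x\<bar> + (1 - 1/2) * \<bar>g x\<bar>) powr p"
      by (subst powr_mult) auto
    also have "\<dots> \<le> 2 powr p * (1/2 * \<bar>f x\<bar> powr p + (1 - 1/2) * \<bar>g x\<bar> powr p)"
      using p by (intro mult_left_mono powr_convex_combination) auto
    also have "\<dots> \<le> 2 powr p * (\<bar>f x\<bar> powr p + \<bar>g x\<bar> powr p)"
      by (intro mult_left_mono add_mono) auto
    finally show ?thesis .
  qed
  have "integrable M (\<lambda>x. 2 powr p * (\<bar>f x\<bar> powr p + \<bar>g x\<bar> powr p))"
    using f g by (auto simp: Lp_funs_def)
  then have "integrable M (\<lambda>x. \<bar>f x - g x\<bar> powr p)"
    by (rule Bochner_Integration.integrable_bound) (use bound in \<open>auto intro!: AE_I2\<close>)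
  then show ?thesis by (simp add: Lp_funs_def)
qed

lemma Lp_norm_nonneg: "0 \<le> Lp_norm M p f"
  by (simp add: Lp_norm_def)

lemma Lp_norm_cong_AE:
  assumes "AE x in M. f x = g x" "f \<in> borel_measurable M" "g \<in> borel_measurable M"
  shows "Lp_norm M p f = Lp_norm M p g"
proof -
  have [measurable]: "f \<in> borel_measurable M" "g \<in> borel_measurable M" by fact+
  have "(\<integral>x. \<bar>f x\<bar> powr p \<partial>M) = (\<integral>x. \<bar>g x\<bar> powr p \<partial>M)"
    using assms(1) by (intro integral_cong_AE) auto
  then show ?thesis by (simp add: Lp_norm_def)
qed

lemma Lp_norm_powr:
  assumes "1 \<le> p"
  shows "Lp_norm M p f powr p = (\<integral>x. \<bar>f x\<bar> powr p \<partial>M)"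
  using assms by (simp add: Lp_norm_def powr_powr)

lemma Lp_norm_eq_0_iff:
  assumes p: "1 \<le> p" and f: "f \<in> Lp_funs M p"
  shows "Lp_norm M p f = 0 \<longleftrightarrow> (AE x in M. f x = 0)"
proof -
  have "Lp_norm M p f = 0 \<longleftrightarrow> (\<integral>x. \<bar>f x\<bar> powr p \<partial>M) = 0"
    by (simp add: Lp_norm_def)
  also have "\<dots> \<longleftrightarrow> (AE x in M. \<bar>f x\<bar> powr p = 0)"
    using f by (intro integral_nonneg_eq_0_iff_AE) (auto simp: Lp_funs_def)
  finally show ?thesis by simp
qed

lemma Lp_norm_triangle:
  assumes p: "1 \<le> p" and f: "f \<in> Lp_funs M p" and g: "g \<in> Lp_funs M p"
    and s: "(\<lambda>x. f x + g x) \<in> Lp_funs M p"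
  shows "Lp_norm M p (\<lambda>x. f x + g x) \<le> Lp_norm M p f + Lp_norm M p g"
proof -
  have [measurable]: "f \<in> borel_measurable M" "g \<in> borel_measurable M"
    using f g by (auto simp: Lp_funs_def)
  define a b where "a = Lp_norm M p f" and "b = Lp_norm M p g"
  have ab: "0 \<le> a" "0 \<le> b" by (auto simp: a_def b_def Lp_norm_nonneg)
  consider "a = 0" | "b = 0" | "a > 0" "b > 0" using ab by linarith
  then show ?thesis
  proof cases
    case 1
    then have "AE x in M. f x = 0" using Lp_norm_eq_0_iff[OF p f] by (simp add: a_def)
    then have "Lp_norm M p (\<lambda>x. f x + g x) = Lp_norm M p g"
      by (intro Lp_norm_cong_AE) auto
    then show ?thesis using ab by (simp add: a_def)
  next
    case 2
    then have "AE x in M. g x = 0" using Lp_norm_eq_0_iff[OF p g] by (simp add: b_def)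
    then have "Lp_norm M p (\<lambda>x. f x + g x) = Lp_norm M p f"
      by (intro Lp_norm_cong_AE) auto
    then show ?thesis using ab by (simp add: b_def)
  next
    case 3
    define t where "t = a / (a + b)"
    have t: "0 \<le> t" "t \<le> 1" "1 - t = b / (a + b)" using 3 by (auto simp: t_def field_simps)
    have int: "integrable M (\<lambda>x. \<bar>f x\<bar> powr p)" "integrable M (\<lambda>x. \<bar>g x\<bar> powr p)"
      using f g by (auto simp: Lp_funs_def)
    let ?R = "\<lambda>x. (a + b) powr p * (t * (\<bar>f x\<bar> powr p / a powr p)
                 + (1 - t) * (\<bar>g x\<bar> powr p / b powr p))"
    have le: "\<bar>f x + g x\<bar> powr p \<le> ?R x" for x
    proof -
      have "\<bar>f x\<bar> + \<bar>g x\<bar> = (a + b) * (t * (\<bar>f x\<bar> / a) + (1 - t) * (\<bar>g x\<bar> / b))"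
        using 3 unfolding t(3) by (simp add: t_def distrib_left)
      then have "\<bar>f x + g x\<bar> \<le> (a + b) * (t * (\<bar>f x\<bar> / a) + (1 - t) * (\<bar>g x\<bar> / b))"
        by (metis abs_triangle_ineq)
      then have "\<bar>f x + g x\<bar> powr p
          \<le> ((a + b) * (t * (\<bar>f x\<bar> / a) + (1 - t) * (\<bar>g x\<bar> / b))) powr p"
        using p by (intro powr_mono2) auto
      also have "\<dots> = (a + b) powr p * (t * (\<bar>f x\<bar> / a) + (1 - t) * (\<bar>g x\<bar> / b)) powr p"
        using ab t by (subst powr_mult) auto
      also have "\<dots> \<le> (a + b) powr p * (t * (\<bar>f x\<bar> / a) powr p + (1 - t) * (\<bar>g x\<bar> / b) powr p)"
        using p ab t by (intro mult_left_mono powr_convex_combination) auto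
      also have "\<dots> = ?R x"
        using ab by (simp add: powr_divide)
      finally show ?thesis .
    qed
    have "(\<integral>x. \<bar>f x + g x\<bar> powr p \<partial>M) \<le> (\<integral>x. ?R x \<partial>M)"
      using s int le by (intro integral_mono) (auto simp: Lp_funs_def)
    also have "\<dots> = (a + b) powr p * (t * ((\<integral>x. \<bar>f x\<bar> powr p \<partial>M) / a powr p)
                     + (1 - t) * ((\<integral>x. \<bar>g x\<bar> powr p \<partial>M) / b powr p))"
      using int by simp
    also have "\<dots> = (a + b) powr p"
      using 3 by (simp add: a_def b_def flip: Lp_norm_powr[OF p])
    finally have "(\<integral>x. \<bar>f x + g x\<bar> powr p \<partial>M) powr (1 / p) \<le> ((a + b) powr p) powr (1 / p)"
      using p by (intro powr_mono2) auto
    also have "\<dots> = a + b" using p ab by (simp add: powr_powr)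
    finally show ?thesis by (simp add: Lp_norm_def a_def b_def)
  qed
qed

lemma equiv_Lp_rel: "equiv (Lp_funs M p) (Lp_rel M p)"
proof (rule equivI)
  show "Lp_rel M p \<subseteq> Lp_funs M p \<times> Lp_funs M p" by (auto simp: Lp_rel_def)
  show "refl_on (Lp_funs M p) (Lp_rel M p)"
    by (auto simp: refl_on_def Lp_rel_def)
  show "sym (Lp_rel M p)"
    by (auto simp: sym_def Lp_rel_def elim: eventually_mono)
  show "trans (Lp_rel M p)"
    by (auto simp: trans_def Lp_rel_def elim: eventually_elim2)
qed

lemma Lp_rep_in: "F \<in> Lp_space M p \<Longrightarrow> Lp_rep F \<in> F"
  using in_quotient_imp_non_empty[OF equiv_Lp_rel, of F M p]
  unfolding Lp_rep_def Lp_space_def by (simp add: some_in_eq)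

lemma Lp_rep_funs: "F \<in> Lp_space M p \<Longrightarrow> Lp_rep F \<in> Lp_funs M p"
  using Lp_rep_in in_quotient_imp_subset[OF equiv_Lp_rel] unfolding Lp_space_def by blast

lemma Metric_space_Lp:
  assumes p: "1 \<le> p"
  shows "Metric_space (Lp_space M p) (Lp_dist M p)"
proof
  fix F G :: "('a \<Rightarrow> real) set"
  show "0 \<le> Lp_dist M p F G" by (simp add: Lp_dist_def Lp_norm_nonneg)
  show "Lp_dist M p F G = Lp_dist M p G F"
    by (simp add: Lp_dist_def Lp_norm_def abs_minus_commute)
next
  fix F G :: "('a \<Rightarrow> real) set"
  assume FG: "F \<in> Lp_space M p" "G \<in> Lp_space M p"
  note fg = Lp_rep_funs[OF FG(1)] Lp_rep_funs[OF FG(2)]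
  have "Lp_dist M p F G = 0 \<longleftrightarrow> (AE x in M. Lp_rep F x - Lp_rep G x = 0)"
    unfolding Lp_dist_def by (rule Lp_norm_eq_0_iff[OF p Lp_funs_diff[OF p fg]])
  also have "\<dots> \<longleftrightarrow> (Lp_rep F, Lp_rep G) \<in> Lp_rel M p"
    using fg by (simp add: Lp_rel_def)
  also have "\<dots> \<longleftrightarrow> F = G"
    using quotient_eq_iff[OF equiv_Lp_rel, of F M p G "Lp_rep F" "Lp_rep G"]
      FG Lp_rep_in[OF FG(1)] Lp_rep_in[OF FG(2)]
    by (auto simp: Lp_space_def)
  finally show "Lp_dist M p F G = 0 \<longleftrightarrow> F = G" .
next
  fix F G H :: "('a \<Rightarrow> real) set"
  assume "F \<in> Lp_space M p" "G \<in> Lp_space M p" "H \<in> Lp_space M p"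
  note r = this[THEN Lp_rep_funs]
  show "Lp_dist M p F H \<le> Lp_dist M p F G + Lp_dist M p G H"
    using Lp_norm_triangle[OF p Lp_funs_diff[OF p r(1,2)] Lp_funs_diff[OF p r(2,3)]]
      Lp_funs_diff[OF p r(1,3)]
    by (simp add: Lp_dist_def)
qed

lemma mspace_Lp_metric: "1 \<le> p \<Longrightarrow> mspace (Lp_metric M p) = Lp_space M p"
  by (simp add: Lp_metric_def Metric_space_Lp Metric_space.mspace_metric)

lemma mdist_Lp_metric: "1 \<le> p \<Longrightarrow> mdist (Lp_metric M p) = Lp_dist M p"
  by (simp add: Lp_metric_def Metric_space_Lp Metric_space.mdist_metric)

lemma zero_ext_measurable:
  assumes "f \<in> borel_measurable (lebesgue_on {0..1})"
  shows "zero_ext f \<in> borel_measurable lebesgue"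
  using borel_measurable_if_I[OF assms] unfolding zero_ext_def by simp

lemma translate_measurable:
  assumes "g \<in> borel_measurable lebesgue"
  shows "translate h g \<in> borel_measurable lebesgue"
proof -
  have "(\<lambda>x. x + h) \<in> lebesgue \<rightarrow>\<^sub>M lebesgue"
    using lebesgue_affine_measurable[of "\<lambda>_::real. 1" h] by (simp add: add.commute)
  then show ?thesis
    using assms unfolding translate_def by (rule measurable_compose)
qed

lemma Lp_modulus_cong_AE:
  assumes fg: "AE x in lebesgue_on {0..1}. f x = g x"
    and f: "f \<in> borel_measurable (lebesgue_on {0..1})"
    and g: "g \<in> borel_measurable (lebesgue_on {0..1})"
  shows "Lp_modulus p \<mu> f \<longleftrightarrow> Lp_modulus p \<mu> g"
proof -
  have eq: "AE x in lebesgue. zero_ext f x = zero_ext g x"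
    using fg by (subst (asm) AE_restrict_space_iff) (auto simp: zero_ext_def elim: eventually_mono)
  have tr: "AE x in lebesgue. translate h (zero_ext f) x = translate h (zero_ext g) x" for h
  proof -
    obtain N where N: "negligible N" "{x. zero_ext f x \<noteq> zero_ext g x} \<subseteq> N"
      using eq unfolding eventually_ae_filter negligible_iff_null_sets by auto
    have "(\<lambda>x. - h + x) ` N \<in> null_sets lebesgue"
      using N(1) negligible_translation negligible_iff_null_sets by blast
    moreover have "{x \<in> space lebesgue. translate h (zero_ext f) x \<noteq> translate h (zero_ext g) x}
        \<subseteq> (\<lambda>x. - h + x) ` N"
    proof
      fix x assume "x \<in> {x \<in> space lebesgue. translate h (zero_ext f) x \<noteq> translate h (zero_ext g) x}"
      then have "x + h \<in> N" using N(2) by (auto simp: translate_def)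
      then show "x \<in> (\<lambda>x. - h + x) ` N" by (intro image_eqI[where x = "x + h"]) auto
    qed
    ultimately show ?thesis by (intro AE_I')
  qed
  have "Lp_norm lebesgue p (\<lambda>x. zero_ext f x - translate h (zero_ext f) x)
      = Lp_norm lebesgue p (\<lambda>x. zero_ext g x - translate h (zero_ext g) x)" for h
  proof (intro Lp_norm_cong_AE borel_measurable_diff translate_measurable zero_ext_measurable f g)
    show "AE x in lebesgue. zero_ext f x - translate h (zero_ext f) x
        = zero_ext g x - translate h (zero_ext g) x"
      using eq tr[of h] by eventually_elim simp
  qed
  then show ?thesis by (simp add: Lp_modulus_def)
qed

end

theory Submission
  imports Defs "HOL-Probability.Probability_Measure"
begin

text \<open>
  Let \<open>N = 2 ^ l (n + 2)\<close>. Composing \<open>N\<close> translations by \<open>1 / N\<close> moves the support of \<open>f\<close> off itself,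
  so the modulus bounds the norm of \<open>f\<close> by \<open>N / 2 ^ (n + 2)\<close>. Replacing \<open>f\<close> by its means over the
  intervals of length \<open>1 / N\<close> costs at most \<open>1 / 2 ^ (n + 1)\<close>: Jensen's inequality bounds the error
  at \<open>x\<close> by the average over \<open>\<bar>h\<bar> \<le> 1 / N\<close> of the increments of \<open>f\<close> from \<open>x\<close> to \<open>x + h\<close>, and Fubini
  reduces this to the modulus. Each mean is at most \<open>N\<close> times the norm; rounding it to a multiple of
  \<open>1 / 2 ^ (n + 1)\<close> leaves at most \<open>2 * N\<^sup>2 + 1\<close> values per interval.
\<close>

section \<open>Norm estimates on finite measure spaces and convexity of the p-th power\<close>

lemma Lp_funs_bounded:
  assumes "finite_measure M" "1 \<le> p" and [measurable]: "f \<in> borel_measurable M"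
    and "\<And>x. x \<in> space M \<Longrightarrow> \<bar>f x\<bar> \<le> b"
  shows "f \<in> Lp_funs M p"
proof -
  interpret finite_measure M by fact
  have "integrable M (\<lambda>x. \<bar>f x\<bar> powr p)"
    by (rule integrable_const_bound[where B = "b powr p"])
       (use assms in \<open>auto intro!: AE_I2 powr_mono2\<close>)
  then show ?thesis by (simp add: Lp_funs_def)
qed

lemma Lp_norm_le_bound:
  assumes "prob_space M" "1 \<le> p" and [measurable]: "f \<in> borel_measurable M"
    and "\<And>x. x \<in> space M \<Longrightarrow> \<bar>f x\<bar> \<le> b" and "0 \<le> b"
  shows "Lp_norm M p f \<le> b"
proof -
  interpret prob_space M by fact
  have "integrable M (\<lambda>x. \<bar>f x\<bar> powr p)"
    using Lp_funs_bounded[of M p f b] assms finite_measure_axioms by (simp add: Lp_funs_def)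
  then have "(\<integral>x. \<bar>f x\<bar> powr p \<partial>M) \<le> b powr p"
    using assms by (intro integral_le_const AE_I2 powr_mono2) auto
  then have "Lp_norm M p f \<le> (b powr p) powr (1 / p)"
    unfolding Lp_norm_def using assms by (intro powr_mono2) auto
  then show ?thesis using assms by (simp add: powr_powr)
qed

text \<open>Constants are integrable here, so \<open>1 + \<bar>f x\<bar> powr p\<close> serves as a
  dominating function. Jensen's inequality requires integrability of the function itself.\<close>

lemma Lp_funs_integrable:
  assumes "finite_measure M" "1 \<le> p" and f: "f \<in> Lp_funs M p"
  shows "integrable M f"
proof -
  interpret finite_measure M by fact
  have [measurable]: "f \<in> borel_measurable M" using f by (simp add: Lp_funs_def)
  have "integrable M (\<lambda>x. 1 + \<bar>f x\<bar> powr p)" using f by (simp add: Lp_funs_def)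
  moreover have "\<bar>f x\<bar> \<le> 1 + \<bar>f x\<bar> powr p" for x
  proof (cases "\<bar>f x\<bar> \<le> 1")
    case False
    then have "\<bar>f x\<bar> powr 1 \<le> \<bar>f x\<bar> powr p" using assms by (intro powr_mono) auto
    then show ?thesis using False by simp
  qed (simp add: add_increasing2)
  ultimately show ?thesis
    by (intro Bochner_Integration.integrable_bound[of M "\<lambda>x. 1 + \<bar>f x\<bar> powr p" f]) (auto intro!: AE_I2)
qed

lemma Lp_funs_nn_integral:
  assumes "1 \<le> p" "f \<in> Lp_funs M p"
  shows "(\<integral>\<^sup>+x. ennreal (\<bar>f x\<bar> powr p) \<partial>M) = ennreal (Lp_norm M p f powr p)"
  using assms by (simp add: Lp_norm_powr Lp_funs_def nn_integral_eq_integral)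

text \<open>A Bochner integral that does not exist is 0, so a bound on \<open>Lp_norm\<close> alone
  would say little. Bounds are therefore derived for \<open>nn_integral\<close>, and membership and
  norm bound are recovered together.\<close>

lemma Lp_normI:
  assumes "1 \<le> p" "0 \<le> c" and [measurable]: "f \<in> borel_measurable M"
    and le: "(\<integral>\<^sup>+x. ennreal (\<bar>f x\<bar> powr p) \<partial>M) \<le> ennreal (c powr p)"
  shows "f \<in> Lp_funs M p" "Lp_norm M p f \<le> c"
proof -
  have "(\<integral>\<^sup>+x. ennreal (\<bar>f x\<bar> powr p) \<partial>M) < \<infinity>"
    using le by (simp add: order_le_less_trans)
  then show f: "f \<in> Lp_funs M p"
    by (simp add: Lp_funs_def integrable_iff_bounded)
  have "Lp_norm M p f powr p \<le> c powr p"
    using le assms by (simp add: Lp_funs_nn_integral[OF \<open>1 \<le> p\<close> f])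
  then show "Lp_norm M p f \<le> c"
    using assms by (meson linorder_not_less powr_less_mono2 less_le_trans zero_less_one)
qed

lemma convex_on_abs_powr:
  fixes p :: real
  assumes "1 \<le> p"
  shows "convex_on UNIV (\<lambda>x::real. \<bar>x\<bar> powr p)"
proof (rule convex_onI)
  fix t x y :: real
  assume t: "0 < t" "t < 1"
  \<comment> \<open>The weight \<open>t\<close> is written \<open>1 - (1 - t)\<close> so that
    \<open>powr_convex_combination\<close> applies with parameter \<open>1 - t\<close>.\<close>
  have "\<bar>(1 - t) *\<^sub>R x + t *\<^sub>R y\<bar> \<le> (1 - t) * \<bar>x\<bar> + (1 - (1 - t)) * \<bar>y\<bar>"
    using t abs_triangle_ineq[of "(1 - t) * x" "t * y"] by (simp add: abs_mult)
  then have "\<bar>(1 - t) *\<^sub>R x + t *\<^sub>R y\<bar> powr p \<le> ((1 - t) * \<bar>x\<bar> + (1 - (1 - t)) * \<bar>y\<bar>) powr p"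
    using assms by (intro powr_mono2) auto
  also have "\<dots> \<le> (1 - t) * \<bar>x\<bar> powr p + (1 - (1 - t)) * \<bar>y\<bar> powr p"
    using assms t by (intro powr_convex_combination) auto
  finally show "\<bar>(1 - t) *\<^sub>R x + t *\<^sub>R y\<bar> powr p \<le> (1 - t) * \<bar>x\<bar> powr p + t * \<bar>y\<bar> powr p"
    by simp
qed simp

section \<open>Means over the cells of a grid\<close>

text \<open>Half-open intervals tile the line: for \<open>N > 0\<close>, each \<open>x\<close> lies
  in exactly one cell, the one indexed by \<open>\<lfloor>N * x\<rfloor>\<close>.\<close>

definition cell :: "real \<Rightarrow> int \<Rightarrow> real set" where
  "cell N i = {of_int i / N..<(of_int i + 1) / N}"

definition cell_mean :: "real \<Rightarrow> (real \<Rightarrow> real) \<Rightarrow> int \<Rightarrow> real" where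
  "cell_mean N g i = (\<integral>y. N * indicator (cell N i) y * g y \<partial>lborel)"

lemma cell_borel [measurable]: "cell N i \<in> sets borel"
  by (simp add: cell_def)

lemma cell_floor_dist:
  assumes "0 < N" "y \<in> cell N \<lfloor>N * x\<rfloor>"
  shows "\<bar>y - x\<bar> \<le> 1 / N"
proof -
  have "of_int \<lfloor>N * x\<rfloor> \<le> N * x" "N * x < of_int \<lfloor>N * x\<rfloor> + 1" by linarith+
  moreover have "of_int \<lfloor>N * x\<rfloor> \<le> N * y" "N * y < of_int \<lfloor>N * x\<rfloor> + 1"
    using assms by (auto simp: cell_def field_simps)
  ultimately have "\<bar>N * y - N * x\<bar> \<le> 1" by linarith
  then have "N * \<bar>y - x\<bar> \<le> 1" using assms by (simp add: abs_mult flip: right_diff_distrib)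
  then show ?thesis using assms by (simp add: field_simps)
qed

text \<open>Jensen's inequality for the probability measure with density \<open>N\<close> on the
  cell, applied to \<open>c - g\<close>. The constant is free because two values matter:
  \<open>c = g x\<close> gives the averaging error at \<open>x\<close>, and \<open>c = 0\<close>
  gives the size of the mean.\<close>

lemma cell_mean_Jensen:
  assumes p: "1 \<le> p" and g: "g \<in> Lp_funs lborel p" and N: "0 < N"
  shows "ennreal (\<bar>c - cell_mean N g i\<bar> powr p)
    \<le> (\<integral>\<^sup>+y. ennreal (N * indicator (cell N i) y * \<bar>c - g y\<bar> powr p) \<partial>lborel)"
proof -
  let ?w = "\<lambda>y. N * indicator (cell N i) y :: real"
  define M where "M = density lborel (\<lambda>y. ennreal (?w y))"
  have [measurable]: "g \<in> borel_measurable borel" using g by (simp add: Lp_funs_def)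
  have "emeasure M (space M) = ennreal N * emeasure lborel (cell N i)"
    unfolding M_def using N
    by (subst emeasure_density) (auto simp: ennreal_mult nn_integral_cmult ennreal_indicator)
  also have "\<dots> = 1"
    using N by (simp add: cell_def ennreal_mult'[symmetric] field_simps)
  finally interpret prob_space M by (rule prob_spaceI)
  have fin: "finite_measure M" by (rule finite_measure_axioms)
  have dens: "integrable M f \<longleftrightarrow> integrable lborel (\<lambda>y. ?w y * f y)"
    "integral\<^sup>L M f = (\<integral>y. ?w y * f y \<partial>lborel)" if "f \<in> borel_measurable borel" for f :: "real \<Rightarrow> real"
    unfolding M_def using N that
    by (subst integrable_real_density integral_real_density; auto intro!: AE_I2)+
  have "integrable lborel (\<lambda>y. ?w y * \<bar>g y\<bar> powr p)"
    by (rule Bochner_Integration.integrable_bound[where f = "\<lambda>y. N * \<bar>g y\<bar> powr p"])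
      (use g N in \<open>auto simp: Lp_funs_def indicator_def intro!: AE_I2\<close>)
  then have gM: "g \<in> Lp_funs M p"
    by (simp add: Lp_funs_def dens) (simp add: M_def)
  have u: "(\<lambda>y. c - g y) \<in> Lp_funs M p"
    by (intro Lp_funs_diff[OF p] gM Lp_funs_bounded[where b = "\<bar>c\<bar>"] fin p) auto
  have "\<bar>\<integral>y. c - g y \<partial>M\<bar> powr p \<le> (\<integral>y. \<bar>c - g y\<bar> powr p \<partial>M)"
    using u Lp_funs_integrable[OF fin p u] convex_on_abs_powr[OF p]
    by (intro jensens_inequality[where I = UNIV]) (auto simp: Lp_funs_def)
  moreover have "(\<integral>y. c - g y \<partial>M) = c - cell_mean N g i"
    using Lp_funs_integrable[OF fin p gM]
    by (simp add: prob_space dens(2)[of g] cell_mean_def)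
  ultimately have "ennreal (\<bar>c - cell_mean N g i\<bar> powr p) \<le> ennreal (\<integral>y. \<bar>c - g y\<bar> powr p \<partial>M)"
    by (simp add: ennreal_leI)
  also have "\<dots> = (\<integral>\<^sup>+y. ennreal (\<bar>c - g y\<bar> powr p) \<partial>M)"
    using u by (intro nn_integral_eq_integral[symmetric]) (auto simp: Lp_funs_def)
  also have "\<dots> = (\<integral>\<^sup>+y. ennreal (?w y * \<bar>c - g y\<bar> powr p) \<partial>lborel)"
    unfolding M_def using N by (subst nn_integral_density) (auto simp: ennreal_mult)
  finally show ?thesis .
qed

lemma cell_mean_le:
  assumes p: "1 \<le> p" and g: "g \<in> Lp_funs lborel p" and N: "1 \<le> N"
  shows "\<bar>cell_mean N g i\<bar> \<le> N * Lp_norm lborel p g"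
proof -
  have [measurable]: "g \<in> borel_measurable borel" using g by (simp add: Lp_funs_def)
  have "ennreal (\<bar>cell_mean N g i\<bar> powr p)
      \<le> (\<integral>\<^sup>+y. ennreal (N * indicator (cell N i) y * \<bar>g y\<bar> powr p) \<partial>lborel)"
    using cell_mean_Jensen[OF p g, of N 0 i] N by simp
  also have "\<dots> \<le> (\<integral>\<^sup>+y. ennreal N * ennreal (\<bar>g y\<bar> powr p) \<partial>lborel)"
    using N by (intro nn_integral_mono) (auto simp: indicator_def ennreal_mult)
  also have "\<dots> = ennreal (N * Lp_norm lborel p g powr p)"
    using N by (simp add: nn_integral_cmult Lp_funs_nn_integral[OF p g] ennreal_mult)
  \<comment> \<open>Since \<open>1 \<le> N\<close> and \<open>1 \<le> p\<close>,
    \<open>N \<le> N powr p\<close>; this brings the factor inside the power.\<close>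
  also have "\<dots> \<le> ennreal ((N * Lp_norm lborel p g) powr p)"
    using N p powr_mono[of 1 p N]
    by (intro ennreal_leI) (simp add: powr_mult Lp_norm_nonneg mult_right_mono)
  finally have "\<bar>cell_mean N g i\<bar> powr p \<le> (N * Lp_norm lborel p g) powr p" by simp
  then show ?thesis
    using p N Lp_norm_nonneg[of lborel p g]
    by (smt (verit) powr_less_mono2 mult_nonneg_nonneg)
qed

lemma nn_integral_translate:
  fixes f :: "real \<Rightarrow> ennreal"
  assumes "f \<in> borel_measurable borel"
  shows "(\<integral>\<^sup>+x. f (x + h) \<partial>lborel) = (\<integral>\<^sup>+x. f x \<partial>lborel)"
  using nn_integral_real_affine[OF assms, of 1 h] by (simp add: add.commute)

lemma nn_integral_cell_mean_diff_le:
  assumes p: "1 \<le> p" and g: "g \<in> Lp_funs lborel p" and N: "0 < N" and D: "0 \<le> D"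
    and mod: "\<And>h. \<bar>h\<bar> \<le> 1 / N \<Longrightarrow> (\<integral>\<^sup>+x. ennreal (\<bar>g x - g (x + h)\<bar> powr p) \<partial>lborel) \<le> ennreal D"
  shows "(\<integral>\<^sup>+x. ennreal (\<bar>g x - cell_mean N g \<lfloor>N * x\<rfloor>\<bar> powr p) \<partial>lborel) \<le> ennreal (2 * D)"
proof -
  have [measurable]: "g \<in> borel_measurable borel" using g by (simp add: Lp_funs_def)
  let ?J = "\<lambda>h. indicator {-1/N..1/N} h :: ennreal"
  have "ennreal (\<bar>g x - cell_mean N g \<lfloor>N * x\<rfloor>\<bar> powr p)
      \<le> (\<integral>\<^sup>+h. ennreal N * (?J h * ennreal (\<bar>g x - g (x + h)\<bar> powr p)) \<partial>lborel)" for x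
  proof -
    have "ennreal (\<bar>g x - cell_mean N g \<lfloor>N * x\<rfloor>\<bar> powr p)
      \<le> (\<integral>\<^sup>+y. ennreal (N * indicator (cell N \<lfloor>N * x\<rfloor>) y * \<bar>g x - g y\<bar> powr p) \<partial>lborel)"
      by (rule cell_mean_Jensen[OF p g N])
    \<comment> \<open>The cell of \<open>x\<close> is enlarged to the window of radius
      \<open>1 / N\<close> around \<open>x\<close>. The range of the increment
      \<open>h = y - x\<close> then no longer depends on \<open>x\<close>, so after Fubini the
      modulus can be used for each fixed \<open>h\<close>.\<close>
    also have "\<dots> \<le> (\<integral>\<^sup>+y. ennreal N * (?J (y - x) * ennreal (\<bar>g x - g y\<bar> powr p)) \<partial>lborel)"
    proof (intro nn_integral_mono)
      fix y
      show "ennreal (N * indicator (cell N \<lfloor>N * x\<rfloor>) y * \<bar>g x - g y\<bar> powr p)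
        \<le> ennreal N * (?J (y - x) * ennreal (\<bar>g x - g y\<bar> powr p))"
        using cell_floor_dist[OF N, of y x] N
        by (cases "y \<in> cell N \<lfloor>N * x\<rfloor>") (auto simp: ennreal_mult indicator_def abs_le_iff)
    qed
    also have "\<dots> = (\<integral>\<^sup>+h. ennreal N * (?J (h + x - x) * ennreal (\<bar>g x - g (h + x)\<bar> powr p)) \<partial>lborel)"
      by (rule nn_integral_translate[symmetric]) measurable
    finally show ?thesis by (simp add: add.commute)
  qed
  then have "(\<integral>\<^sup>+x. ennreal (\<bar>g x - cell_mean N g \<lfloor>N * x\<rfloor>\<bar> powr p) \<partial>lborel)
    \<le> (\<integral>\<^sup>+x. \<integral>\<^sup>+h. ennreal N * (?J h * ennreal (\<bar>g x - g (x + h)\<bar> powr p)) \<partial>lborel \<partial>lborel)"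
    by (intro nn_integral_mono)
  also have "\<dots> = (\<integral>\<^sup>+h. \<integral>\<^sup>+x. ennreal N * (?J h * ennreal (\<bar>g x - g (x + h)\<bar> powr p)) \<partial>lborel \<partial>lborel)"
    by (rule lborel_pair.Fubini'[symmetric]) measurable
  also have "\<dots> = (\<integral>\<^sup>+h. ennreal N * (?J h * (\<integral>\<^sup>+x. ennreal (\<bar>g x - g (x + h)\<bar> powr p) \<partial>lborel)) \<partial>lborel)"
    by (simp add: nn_integral_cmult)
  also have "\<dots> \<le> (\<integral>\<^sup>+h. ennreal (N * D) * ?J h \<partial>lborel)"
    using mod N D
    by (intro nn_integral_mono)
       (auto simp: indicator_def ennreal_mult abs_le_iff intro!: mult_left_mono)
  \<comment> \<open>The window has length \<open>2 / N\<close> and carries density \<open>N\<close>,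
    whence the factor 2.\<close>
  also have "\<dots> = ennreal (2 * D)"
    using N D by (simp add: nn_integral_cmult ennreal_mult'[symmetric] field_simps)
  finally show ?thesis .
qed

section \<open>Bounding the norm through iterated translations\<close>

lemma Lp_translate:
  fixes f :: "real \<Rightarrow> real"
  assumes "f \<in> Lp_funs lborel p"
  shows "(\<lambda>x. f (x + h)) \<in> Lp_funs lborel p"
    and "Lp_norm lborel p (\<lambda>x. f (x + h)) = Lp_norm lborel p f"
proof -
  have [measurable]: "f \<in> borel_measurable borel" using assms by (simp add: Lp_funs_def)
  show "(\<lambda>x. f (x + h)) \<in> Lp_funs lborel p"
    using assms lborel_integrable_real_affine[of "\<lambda>x. \<bar>f x\<bar> powr p" 1 h]
    by (simp add: Lp_funs_def add.commute)
  show "Lp_norm lborel p (\<lambda>x. f (x + h)) = Lp_norm lborel p f"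
    using lborel_integral_real_affine[of 1 "\<lambda>x. \<bar>f x\<bar> powr p" h]
    by (simp add: Lp_norm_def add.commute)
qed

text \<open>The difference telescopes into \<open>k\<close> translates of the single increment
  \<open>g x - g (x + h)\<close>, and translation preserves the norm.\<close>

lemma Lp_norm_iterated_translate:
  assumes p: "1 \<le> p" and g: "g \<in> Lp_funs lborel p"
    and c: "Lp_norm lborel p (\<lambda>x. g x - g (x + h)) \<le> c"
  shows "Lp_norm lborel p (\<lambda>x. g x - g (x + real k * h)) \<le> real k * c"
proof (induction k)
  case 0
  then show ?case using p by (simp add: Lp_norm_def)
next
  case (Suc k)
  define u where "u = (\<lambda>x. g x - g (x + h))"
  note diff = Lp_funs_diff[OF p g Lp_translate(1)[OF g]]
  have u: "u \<in> Lp_funs lborel p" unfolding u_def by (rule diff)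
  have eq: "(\<lambda>x. g x - g (x + real (Suc k) * h))
      = (\<lambda>x. (g x - g (x + real k * h)) + u (x + real k * h))"
    by (auto simp: u_def algebra_simps)
  have "Lp_norm lborel p (\<lambda>x. g x - g (x + real (Suc k) * h))
      \<le> Lp_norm lborel p (\<lambda>x. g x - g (x + real k * h)) + Lp_norm lborel p (\<lambda>x. u (x + real k * h))"
    unfolding eq by (intro Lp_norm_triangle p diff Lp_translate(1)[OF u]) (simp flip: eq add: diff)
  also have "\<dots> \<le> real k * c + c"
    unfolding Lp_translate(2)[OF u] using Suc.IH c by (simp add: u_def add_mono)
  finally show ?case by (simp add: algebra_simps)
qed

text \<open>The points \<open>x\<close> and \<open>x + 1\<close> are never both in the open unit
  interval, so the shift by 1, made of \<open>N\<close> shifts by \<open>1 / N\<close>, separates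
  the supports at every point. With the closed interval this would fail at
  \<open>x = 0\<close>.\<close>

lemma Lp_norm_le_translate_diff:
  assumes p: "1 \<le> p" and g: "g \<in> Lp_funs lborel p" and supp: "\<And>x. x \<notin> {0<..<1} \<Longrightarrow> g x = 0"
    and N: "0 < N" and c: "Lp_norm lborel p (\<lambda>x. g x - g (x + 1 / real N)) \<le> c"
  shows "Lp_norm lborel p g \<le> real N * c"
proof -
  have "\<bar>g x\<bar> \<le> \<bar>g x - g (x + 1)\<bar>" for x
    using supp[of x] supp[of "x + 1"] by (cases "x \<in> {0<..<1}") auto
  then have "(\<integral>x. \<bar>g x\<bar> powr p \<partial>lborel) \<le> (\<integral>x. \<bar>g x - g (x + 1)\<bar> powr p \<partial>lborel)"
    using p g Lp_funs_diff[OF p g Lp_translate(1)[OF g]]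
    by (intro integral_mono powr_mono2) (auto simp: Lp_funs_def)
  then have "Lp_norm lborel p g \<le> Lp_norm lborel p (\<lambda>x. g x - g (x + 1))"
    using p by (auto simp: Lp_norm_def intro!: powr_mono2)
  also have "\<dots> \<le> real N * c"
    using Lp_norm_iterated_translate[OF p g c, of N] N by simp
  finally show ?thesis .
qed

section \<open>Passage from Lebesgue measurable to Borel functions\<close>

text \<open>Fubini needs \<open>(x, h) \<mapsto> f (x + h)\<close> to be product measurable, which may fail for a merely Lebesgue
  measurable \<open>f\<close>; hence the passage to a Borel function.\<close>

lemma Lp_funs_borel_representative:
  fixes f :: "real \<Rightarrow> real"
  assumes f: "f \<in> Lp_funs (lebesgue_on {0..1}) p"
  obtains g where "g \<in> Lp_funs lborel p" "\<And>x. x \<notin> {0<..<1} \<Longrightarrow> g x = 0"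
    "AE x in lebesgue_on {0..1}. f x = g x"
proof -
  have fm: "f \<in> borel_measurable (lebesgue_on {0..1})" using f by (simp add: Lp_funs_def)
  obtain g' where g'[measurable]: "g' \<in> borel_measurable lborel"
    and eq: "AE x in lborel. zero_ext f x = g' x"
    using completion_ex_borel_measurable_real[OF zero_ext_measurable[OF fm]] by auto
  \<comment> \<open>Cutting off to the open interval changes the function on a null set only and
    gives the support condition at every point, as the shift by 1 requires.\<close>
  define g where "g = (\<lambda>x. indicator {0<..<1::real} x * g' x)"
  have [measurable]: "g \<in> borel_measurable borel" unfolding g_def by measurable
  have "AE x in lborel. zero_ext f x = g x"
    using eq AE_lborel_singleton[of 0] AE_lborel_singleton[of 1]
    by eventually_elim (auto simp: g_def zero_ext_def indicator_def split: if_splits)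
  then have eq': "AE x in lebesgue. zero_ext f x = g x" by (rule AE_completion)
  then have "AE x in lebesgue. x \<in> {0..1} \<longrightarrow> f x = g x"
    by eventually_elim (auto simp: zero_ext_def)
  then have ae: "AE x in lebesgue_on {0..1}. f x = g x"
    by (simp add: AE_restrict_space_iff)
  have "integrable lebesgue (\<lambda>x. indicator {0..1} x *\<^sub>R (\<bar>f x\<bar> powr p))"
    using f by (subst integrable_restrict_space[symmetric]) (auto simp: Lp_funs_def)
  also have "(\<lambda>x. indicator {0..1} x *\<^sub>R (\<bar>f x\<bar> powr p)) = (\<lambda>x. \<bar>zero_ext f x\<bar> powr p)"
    by (auto simp: zero_ext_def indicator_def)
  finally have "integrable lebesgue (\<lambda>x. \<bar>g x\<bar> powr p)"
  proof (rule integrable_cong_AE_imp)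
    show "AE x in lebesgue. \<bar>zero_ext f x\<bar> powr p = \<bar>g x\<bar> powr p"
      using eq' by eventually_elim simp
  qed (rule measurable_completion, measurable)
  then have "g \<in> Lp_funs lborel p"
    by (simp add: Lp_funs_def integrable_completion)
  then show thesis using ae by (intro that) (auto simp: g_def)
qed

text \<open>A function vanishing off the open unit interval is its own zero extension, and
  completing the measure does not change integrals of Borel functions.\<close>

lemma Lp_modulus_lborel:
  assumes l: "Lp_modulus p l g" and [measurable]: "g \<in> borel_measurable borel"
    and supp: "\<And>x. x \<notin> {0<..<1} \<Longrightarrow> g x = 0" and h: "\<bar>h\<bar> \<le> 1 / 2 ^ l n"
  shows "Lp_norm lborel p (\<lambda>x. g x - g (x + h)) < 1 / 2 ^ n"
proof -
  have "zero_ext g = g" using supp by (force simp: zero_ext_def)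
  then have "Lp_norm lebesgue p (\<lambda>x. g x - g (x + h)) < 1 / 2 ^ n"
    using l h by (simp add: Lp_modulus_def translate_def)
  then show ?thesis by (simp add: Lp_norm_def integral_completion)
qed

section \<open>Approximation by grid functions with quantized values\<close>

lemma floor_compose_measurable [measurable]:
  fixes \<phi> :: "int \<Rightarrow> real" and N :: real
  shows "(\<lambda>x. \<phi> \<lfloor>N * x\<rfloor>) \<in> borel_measurable borel"
proof -
  have "(\<lambda>x. \<lfloor>N * x\<rfloor>) \<in> borel \<rightarrow>\<^sub>M count_space UNIV" by measurable
  then show ?thesis by (rule measurable_compose) simp
qed

lemma prob_space_unit_interval: "prob_space (lebesgue_on {0..1::real})"
  by (rule prob_spaceI) (simp add: emeasure_restrict_space)

text \<open>The point \<open>x = 1\<close> lies in cell number \<open>N\<close>, so \<open>N + 1\<close> values of \<open>\<phi>\<close> matter.\<close>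

definition grid_fun :: "nat \<Rightarrow> real \<Rightarrow> (int \<Rightarrow> int) \<Rightarrow> real \<Rightarrow> real" where
  "grid_fun N \<epsilon> \<phi> x = \<epsilon> * of_int (\<phi> \<lfloor>real N * x\<rfloor>)"

lemma grid_fun_measurable: "grid_fun N \<epsilon> \<phi> \<in> borel_measurable (lebesgue_on {0..1})"
proof -
  have "grid_fun N \<epsilon> \<phi> \<in> borel_measurable borel"
    unfolding grid_fun_def using floor_compose_measurable[of "\<lambda>i. \<epsilon> * of_int (\<phi> i)" "real N"] by simp
  then have "grid_fun N \<epsilon> \<phi> \<in> borel_measurable lebesgue"
    by (intro measurable_completion) simp
  then show ?thesis by (rule measurable_restrict_space1)
qed

lemma floor_in_range:
  assumes "x \<in> {0..1}"
  shows "\<lfloor>real N * x\<rfloor> \<in> {0..int N}"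
proof -
  have "real N * x \<le> real N" using assms by (simp add: mult_left_le)
  then have "\<lfloor>real N * x\<rfloor> \<le> int N" by linarith
  then show ?thesis using assms by simp
qed

lemma grid_fun_Lp:
  assumes "1 \<le> p" "\<phi> \<in> {0..int N} \<rightarrow>\<^sub>E {-K..K}"
  shows "grid_fun N \<epsilon> \<phi> \<in> Lp_funs (lebesgue_on {0..1}) p"
proof (rule Lp_funs_bounded[OF _ assms(1) grid_fun_measurable])
  show "finite_measure (lebesgue_on {0..1::real})"
    using prob_space_unit_interval by (rule prob_space.finite_measure)
  fix x :: real assume "x \<in> space (lebesgue_on {0..1})"
  then have "\<phi> \<lfloor>real N * x\<rfloor> \<in> {-K..K}"
    using floor_in_range[of x N] assms(2) by auto
  then have "\<bar>\<phi> \<lfloor>real N * x\<rfloor>\<bar> \<le> K" by auto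
  then have "\<bar>real_of_int (\<phi> \<lfloor>real N * x\<rfloor>)\<bar> \<le> of_int K" by linarith
  then show "\<bar>grid_fun N \<epsilon> \<phi> x\<bar> \<le> \<bar>\<epsilon>\<bar> * of_int K"
    by (simp add: grid_fun_def abs_mult mult_left_mono)
qed

text \<open>Error budget with \<delta> = 1 / 2^(n + 2): averaging costs at most 2 \<delta>, rounding
  at most \<delta>. The total 3 \<delta> is strictly below 4 \<delta> = 1 / 2^n, as open balls
  demand.\<close>

lemma Lp_modulus_grid_approximation:
  fixes l :: "nat \<Rightarrow> nat" and n :: nat
  defines "N \<equiv> 2 ^ l (n + 2)"
  assumes p: "1 \<le> p" and f: "f \<in> Lp_funs (lebesgue_on {0..1}) p" and l: "Lp_modulus p l f"
  shows "\<exists>\<phi> \<in> {0..int N} \<rightarrow>\<^sub>E {- (int N)\<^sup>2..(int N)\<^sup>2}.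
    Lp_norm (lebesgue_on {0..1}) p (\<lambda>x. grid_fun N (1 / 2 ^ (n + 1)) \<phi> x - f x) < 1 / 2 ^ n"
proof -
  let ?U = "lebesgue_on {0..1::real}"
  define \<delta> :: real where "\<delta> = 1 / 2 ^ (n + 2)"
  have \<delta>: "0 < \<delta>" "1 / 2 ^ (n + 1) = 2 * \<delta>" "1 / 2 ^ n = 4 * \<delta>" by (auto simp: \<delta>_def)
  have N: "1 \<le> N" "1 \<le> real N" "0 < N" "0 < real N" by (auto simp: N_def)
  interpret U: prob_space ?U by (rule prob_space_unit_interval)
  have finU: "finite_measure ?U" by (rule U.finite_measure_axioms)
  obtain g where g: "g \<in> Lp_funs lborel p" and supp: "\<And>x. x \<notin> {0<..<1} \<Longrightarrow> g x = 0"
    and fg: "AE x in ?U. f x = g x"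
    using Lp_funs_borel_representative[OF f] by blast
  have [measurable]: "g \<in> borel_measurable borel" using g by (simp add: Lp_funs_def)
  have fU[measurable]: "f \<in> borel_measurable ?U" using f by (simp add: Lp_funs_def)
  have toU: "u \<in> borel_measurable ?U" if "u \<in> borel_measurable borel" for u :: "real \<Rightarrow> real"
    using that by (intro measurable_restrict_space1 measurable_completion) simp
  have gU[measurable]: "g \<in> borel_measurable ?U" by (rule toU) simp
  have lg: "Lp_modulus p l g" using l Lp_modulus_cong_AE[OF fg fU gU] by simp
  have mod: "Lp_norm lborel p (\<lambda>x. g x - g (x + h)) \<le> \<delta>" if "\<bar>h\<bar> \<le> 1 / real N" for h
    using Lp_modulus_lborel[OF lg _ supp, of h "n + 2"] that by (simp add: N_def \<delta>_def)

  define A where "A = cell_mean (real N) g"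
  define a where "a = (\<lambda>x. A \<lfloor>real N * x\<rfloor>)"
  have a_borel[measurable]: "a \<in> borel_measurable borel" unfolding a_def by measurable
  have aU[measurable]: "a \<in> borel_measurable ?U" by (rule toU) simp
  have "Lp_norm lborel p g \<le> real N * \<delta>"
    using mod[of "1 / real N"] N by (intro Lp_norm_le_translate_diff[OF p g supp]) auto
  then have A_le: "\<bar>A i\<bar> \<le> (real N)\<^sup>2 * \<delta>" for i
    using cell_mean_le[OF p g N(2), of i] mult_left_mono[of "Lp_norm lborel p g" "real N * \<delta>" "real N"]
    by (simp add: A_def power2_eq_square mult.assoc order_trans)

  have "(\<integral>\<^sup>+x. ennreal (\<bar>g x - g (x + h)\<bar> powr p) \<partial>lborel) \<le> ennreal (\<delta> powr p)" if "\<bar>h\<bar> \<le> 1 / real N" for h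
    using mod[OF that] p
    by (subst Lp_funs_nn_integral[OF p Lp_funs_diff[OF p g Lp_translate(1)[OF g]]])
       (auto intro!: ennreal_leI powr_mono2 simp: Lp_norm_nonneg)
  from nn_integral_cell_mean_diff_le[OF p g N(4) _ this]
  have "(\<integral>\<^sup>+x. ennreal (\<bar>g x - a x\<bar> powr p) \<partial>lborel) \<le> ennreal (2 * \<delta> powr p)"
    by (simp add: a_def A_def)
  \<comment> \<open>The factor 2 from the averaging window is absorbed into the norm, as
    \<open>2 \<le> 2 powr p\<close>.\<close>
  also have "\<dots> \<le> ennreal ((2 * \<delta>) powr p)"
    using p \<delta> powr_mono[of 1 p 2] by (intro ennreal_leI) (simp add: powr_mult mult_right_mono)
  finally have ga: "(\<integral>\<^sup>+x. ennreal (\<bar>g x - a x\<bar> powr p) \<partial>lborel) \<le> ennreal ((2 * \<delta>) powr p)" .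
  have "(\<integral>\<^sup>+x. ennreal (\<bar>a x - f x\<bar> powr p) \<partial>?U) = (\<integral>\<^sup>+x. ennreal (\<bar>g x - a x\<bar> powr p) \<partial>?U)"
    using fg by (intro nn_integral_cong_AE) (auto simp: abs_minus_commute)
  also have "\<dots> \<le> (\<integral>\<^sup>+x. ennreal (\<bar>g x - a x\<bar> powr p) \<partial>lebesgue)"
    by (subst nn_integral_restrict_space) (auto intro!: nn_integral_mono simp: indicator_def)
  also have "\<dots> \<le> ennreal ((2 * \<delta>) powr p)"
    using ga by (simp add: nn_integral_completion)
  finally have af: "(\<lambda>x. a x - f x) \<in> Lp_funs ?U p" "Lp_norm ?U p (\<lambda>x. a x - f x) \<le> 2 * \<delta>"
    using Lp_normI[OF p, of "2 * \<delta>" "\<lambda>x. a x - f x" ?U] \<delta> by auto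

  \<comment> \<open>Rounding to the nearest multiple of \<open>2 * \<delta>\<close> costs at most
    \<delta>. The \<open>restrict\<close> makes the coefficient function extensional, so that it
    belongs to a finite function space.\<close>
  define \<phi> where "\<phi> = restrict (\<lambda>i. round (A i / (2 * \<delta>))) {0..int N}"
  have \<phi>: "\<phi> \<in> {0..int N} \<rightarrow>\<^sub>E {- (int N)\<^sup>2..(int N)\<^sup>2}"
  proof -
    have "\<bar>round (A i / (2 * \<delta>))\<bar> \<le> (int N)\<^sup>2" for i
    proof -
      \<comment> \<open>The quotient is at most half of \<open>N\<close> squared; rounding adds at
        most 1/2, which is covered by the other half since \<open>N \<ge> 1\<close>.\<close>
      have "\<bar>A i / (2 * \<delta>)\<bar> \<le> (real N)\<^sup>2 / 2"
        using A_le[of i] \<delta> by (simp add: abs_mult field_simps)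
      moreover have "\<bar>of_int (round (A i / (2 * \<delta>))) - A i / (2 * \<delta>)\<bar> \<le> 1 / 2"
        by (rule of_int_round_abs_le)
      moreover have "1 \<le> (real N)\<^sup>2" using N by simp
      ultimately have "\<bar>real_of_int (round (A i / (2 * \<delta>)))\<bar> \<le> (real N)\<^sup>2" by argo
      then have "real_of_int \<bar>round (A i / (2 * \<delta>))\<bar> \<le> real_of_int ((int N)\<^sup>2)" by simp
      then show ?thesis by (simp only: of_int_le_iff)
    qed
    then show ?thesis by (auto simp: \<phi>_def abs_le_iff minus_le_iff)
  qed
  define s where "s = grid_fun N (2 * \<delta>) \<phi>"
  have s: "s \<in> Lp_funs ?U p" unfolding s_def by (rule grid_fun_Lp[OF p \<phi>])
  then have [measurable]: "s \<in> borel_measurable ?U" by (simp add: Lp_funs_def)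
  have close: "\<bar>s x - a x\<bar> \<le> \<delta>" if "x \<in> space ?U" for x
  proof -
    let ?y = "A \<lfloor>real N * x\<rfloor> / (2 * \<delta>)"
    have "s x = 2 * \<delta> * of_int (round ?y)"
      using that floor_in_range[of x N] by (simp add: s_def grid_fun_def \<phi>_def)
    moreover have "a x = 2 * \<delta> * ?y" using \<delta> by (simp add: a_def)
    ultimately have "\<bar>s x - a x\<bar> = 2 * \<delta> * \<bar>of_int (round ?y) - ?y\<bar>"
      using \<delta> by (simp only: abs_mult flip: right_diff_distrib)
    also have "\<dots> \<le> 2 * \<delta> * (1 / 2)"
      using \<delta> by (intro mult_left_mono of_int_round_abs_le) auto
    finally show ?thesis by simp
  qed
  have sa: "(\<lambda>x. s x - a x) \<in> Lp_funs ?U p"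
    using close by (intro Lp_funs_bounded[OF finU p, where b = \<delta>]) auto
  have "Lp_norm ?U p (\<lambda>x. s x - f x) \<le> Lp_norm ?U p (\<lambda>x. s x - a x) + Lp_norm ?U p (\<lambda>x. a x - f x)"
    using Lp_norm_triangle[OF p sa af(1)] Lp_funs_diff[OF p s f] by simp
  also have "\<dots> \<le> \<delta> + 2 * \<delta>"
    using close \<delta> by (intro add_mono af(2) Lp_norm_le_bound[OF prob_space_unit_interval p]) auto
  also have "\<dots> < 4 * \<delta>" using \<delta> by simp
  finally show ?thesis using \<phi> unfolding \<delta>(2,3) s_def by blast
qed

section \<open>Finite nets, counting and the entropy bound\<close>

text \<open>\<open>Lp_dist\<close> works with chosen representatives. Changing one within its class
  alters the integrand on a null set only, so the distance can be computed from the explicit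
  function \<open>s\<close>.\<close>

lemma Lp_dist_class:
  assumes s: "s \<in> Lp_funs M p" and F: "F \<in> Lp_space M p"
  shows "Lp_dist M p (Lp_rel M p `` {s}) F = Lp_norm M p (\<lambda>x. s x - Lp_rep F x)"
proof -
  have S: "Lp_rel M p `` {s} \<in> Lp_space M p"
    unfolding Lp_space_def using s by (rule quotientI)
  have "(s, Lp_rep (Lp_rel M p `` {s})) \<in> Lp_rel M p"
    using Lp_rep_in[OF S] by simp
  then have "AE x in M. s x = Lp_rep (Lp_rel M p `` {s}) x"
    unfolding Lp_rel_def by blast
  then show ?thesis
    unfolding Lp_dist_def using s Lp_rep_funs[OF S] Lp_rep_funs[OF F]
    by (intro Lp_norm_cong_AE) (auto simp: Lp_funs_def)
qed

lemma metric_entropy_le: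
  assumes S: "finite S" "S \<noteq> {}" "card S \<le> 2 ^ k" "S \<subseteq> mspace m" and K: "K \<subseteq> mspace m"
    and cover: "\<And>x. x \<in> K \<Longrightarrow> \<exists>c\<in>S. mdist m c x < 1 / 2 ^ n"
  shows "metric_entropy m K n \<le> enat k"
proof -
  obtain e where e: "bij_betw e {0..<card S} S"
    using ex_bij_betw_nat_finite[OF S(1)] by blast
  \<comment> \<open>The definition of entropy wants a centre for every index below
    \<open>2 ^ k\<close>; surplus indices repeat \<open>e 0\<close>, which exists as
    \<open>S\<close> is nonempty.\<close>
  define c where "c i = (if i < card S then e i else e 0)" for i
  have "0 < card S" using S by (simp add: card_gt_0_iff)
  then have c: "c i \<in> S" for i
    using e by (auto simp: c_def bij_betw_def)
  have "\<exists>i<2 ^ k. x \<in> mball_of m (c i) (1 / 2 ^ n)" if x: "x \<in> K" for x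
  proof -
    obtain y where y: "y \<in> S" "mdist m y x < 1 / 2 ^ n" using cover[OF x] by blast
    then obtain i where "i < card S" "e i = y"
      using e by (metis atLeastLessThan_iff bij_betw_iff_bijections)
    then show ?thesis
      using y x S K by (intro exI[of _ i]) (auto simp: c_def)
  qed
  then have "K \<subseteq> (\<Union>i\<in>{..<(2::nat) ^ k}. mball_of m (c i) (1 / 2 ^ n))" by blast
  then show ?thesis
    unfolding metric_entropy_def using c S(4) by (intro INF_lower CollectI exI[of _ c]) auto
qed

text \<open>There are \<open>(2 * N\<^sup>2 + 1) ^ (N + 1)\<close> functions. The base is at most
  \<open>2 ^ (2 * m + 2)\<close>, and the resulting exponent \<open>2 * (m + 1) * (N + 1)\<close> is
  at most \<open>(2 * N)\<^sup>2\<close>, again \<open>2 ^ (2 * m + 2)\<close>.\<close>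

lemma card_grid_le:
  fixes m :: nat
  defines "N \<equiv> 2 ^ m"
  shows "card ({0..int N} \<rightarrow>\<^sub>E {- (int N)\<^sup>2..(int N)\<^sup>2}) \<le> 2 ^ 2 ^ (2 * m + 2)"
proof -
  have N: "1 \<le> N" by (simp add: N_def)
  have card_vals: "card {- (int N)\<^sup>2..(int N)\<^sup>2} = 2 * N\<^sup>2 + 1"
    by (simp add: nat_add_distrib nat_mult_distrib nat_power_eq)
  have "card ({0..int N} \<rightarrow>\<^sub>E {- (int N)\<^sup>2..(int N)\<^sup>2}) = (2 * N\<^sup>2 + 1) ^ (N + 1)"
    unfolding card_PiE[OF finite_atLeastAtMost_int] card_vals by (simp add: nat_add_distrib)
  also have "\<dots> \<le> (2 ^ (2 * m + 2)) ^ (N + 1)"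
  proof (rule power_mono)
    have "2 * N\<^sup>2 + 1 \<le> 4 * N\<^sup>2" using N by simp
    then show "2 * N\<^sup>2 + 1 \<le> 2 ^ (2 * m + 2)"
      by (simp add: N_def power_add power_mult power2_eq_square flip: power_mult_distrib)
  qed simp
  also have "\<dots> = 2 ^ (2 * (m + 1) * (N + 1))"
    unfolding power_mult[symmetric] by (simp add: distrib_left)
  also have "\<dots> \<le> 2 ^ 2 ^ (2 * m + 2)"
  proof (rule power_increasing)
    \<comment> \<open>This turns the factor linear in \<open>m\<close> into a power of 2.\<close>
    have "m + 1 \<le> N" unfolding N_def using less_exp[of m] by (simp add: Suc_le_eq)
    then have "2 * (m + 1) * (N + 1) \<le> 2 * N * (2 * N)" using N by (intro mult_mono) auto
    also have "\<dots> = 2 ^ (2 * m + 2)"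
      by (simp add: N_def power_add power_mult power2_eq_square flip: power_mult_distrib)
    finally show "2 * (m + 1) * (N + 1) \<le> 2 ^ (2 * m + 2)" .
  qed simp
  finally show ?thesis .
qed

theorem theorem5p26:
  fixes p :: real
  assumes "1 \<le> p"
  shows "\<exists>A B C :: nat. \<forall>(l :: nat \<Rightarrow> nat) (n :: nat).
           metric_entropy (Lp01 p) (Lp_modulus_class p l) n
             \<le> enat (2 ^ (A * l (n + 1 + 1) + l 0 + B) + n + C)"
proof (intro exI allI)
  fix l :: "nat \<Rightarrow> nat" and n :: nat
  let ?U = "lebesgue_on {0..1::real}"
  define m where "m = l (n + 2)"
  define N :: nat where "N = 2 ^ m"
  define \<Phi> where "\<Phi> = {0..int N} \<rightarrow>\<^sub>E {- (int N)\<^sup>2..(int N)\<^sup>2}"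
  define s where "s = grid_fun N (1 / 2 ^ (n + 1))"
  define S where "S = (\<lambda>\<phi>. Lp_rel ?U p `` {s \<phi>}) ` \<Phi>"
  have s: "s \<phi> \<in> Lp_funs ?U p" if "\<phi> \<in> \<Phi>" for \<phi>
    using grid_fun_Lp[OF assms] that unfolding s_def \<Phi>_def by blast
  have fin: "finite \<Phi>" unfolding \<Phi>_def by (intro finite_PiE) auto
  have "metric_entropy (Lp01 p) (Lp_modulus_class p l) n \<le> enat (2 ^ (2 * m + 2))"
  proof (rule metric_entropy_le)
    show "finite S" using fin by (simp add: S_def)
    show "S \<noteq> {}" by (auto simp: S_def \<Phi>_def PiE_eq_empty_iff)
    show "card S \<le> 2 ^ 2 ^ (2 * m + 2)"
      using card_image_le[OF fin] card_grid_le[of m]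
      unfolding S_def \<Phi>_def N_def by (rule order_trans)
    show "S \<subseteq> mspace (Lp01 p)"
      using s by (auto simp: S_def mspace_Lp_metric[OF assms] Lp_space_def intro: quotientI)
    show "Lp_modulus_class p l \<subseteq> mspace (Lp01 p)" by (auto simp: Lp_modulus_class_def)
    fix F assume "F \<in> Lp_modulus_class p l"
    then have F: "F \<in> Lp_space ?U p" "\<And>f. f \<in> F \<Longrightarrow> Lp_modulus p l f"
      by (auto simp: Lp_modulus_class_def mspace_Lp_metric[OF assms])
    \<comment> \<open>Membership in the class gives the modulus for every representative, hence for
      \<open>Lp_rep F\<close>, the one that enters the distance.\<close>
    obtain \<phi> where \<phi>: "\<phi> \<in> \<Phi>" "Lp_norm ?U p (\<lambda>x. s \<phi> x - Lp_rep F x) < 1 / 2 ^ n"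
      using Lp_modulus_grid_approximation[OF assms Lp_rep_funs[OF F(1)] F(2)[OF Lp_rep_in[OF F(1)]], of n]
      unfolding \<Phi>_def s_def N_def m_def by blast
    then show "\<exists>c\<in>S. mdist (Lp01 p) c F < 1 / 2 ^ n"
      using Lp_dist_class[OF s[OF \<phi>(1)] F(1)] by (auto simp: S_def mdist_Lp_metric[OF assms] intro!: bexI[of _ \<phi>])
  qed
  \<comment> \<open>The constants, left schematic by \<open>exI\<close>, become
    \<open>A = 2\<close>, \<open>B = 2\<close> and \<open>C = 0\<close>; monotonicity of the power
    brings the bound into the required shape.\<close>
  also have "\<dots> \<le> enat (2 ^ (2 * l (n + 1 + 1) + l 0 + 2) + n + 0)"
    using power_increasing[of "2 * m + 2" "2 * m + l 0 + 2" "2::nat"]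
    by (simp add: m_def trans_le_add1)
  finally show "metric_entropy (Lp01 p) (Lp_modulus_class p l) n
      \<le> enat (2 ^ (2 * l (n + 1 + 1) + l 0 + 2) + n + 0)" .
qed

end
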